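(* Let $f=\frac1N\sum_{i=1}^N f_i$ be uniformly convex of degree $q\ge2$ with constant $\sigma_q>0$ and admit a stochastic $p\ge1$ higher-order surrogate function $g$ over $\mathcal X$ with $L_p^{h_j}=L_p^h$ for all $j$. Let $x^*$ be the unique minimizer of $f$ over $\mathcal X$, and let $(x_k)$, $\hat x_k=(x_k^1,\dots,x_k^N)$ be generated by SHOM with minibatch size $\tau$, each $x_{k+1}$ being a global minimizer of $\min_{y\in\mathcal X}g(y;\hat x_k)$. Put $$\mathcal W_k=\frac1N\sum_{j=1}^N\|x^*-x_k^j\|^{p+1} .$$ Then for all $k\ge0$ $$\mathbb E\left[\mathcal W_{k+1}\mid S_0,\dots,S_k\right]\le\left[1-\frac\tau N+\frac\tau N\left(\frac{L_p^hq}{\sigma_q(p+1)!}\right)^{\frac{p+1}{q}}\mathcal W_k^{\frac{p+1-q}{q}}\right]\mathcal W_k .$$ Furthermore, let $\alpha\in(0,1)$ and $\bar C=\frac{L_p^hq}{\sigma_q(p+1)!}$. If $q<p+1$ and $\|x_0-x^*\|\le\dfrac{\alpha^{\frac{q}{(p+1)^2-q(p+1)}}}{\bar C^{\frac1{p+1-q}}}$, then for all $k\ge 0$ $$\mathbb E\left[\mathcal W_{k+1}\mid S_0,\dots,S_k\right]\le\left(1-\frac{(1-\alpha)\tau}{N}\right)\mathcal W_k .$$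
   Context: Setting. $E$ is a finite-dimensional real vector space with dual $E^*$; $B=B^*\succ0$, $B:E\to E^*$, defines the norm $\|x\|=\langle Bx,x\rangle^{1/2}$ on $E$. The norm of a symmetric $p$-multilinear form $D^p\psi(x)$ is $\max_{\|h\|\le1}|D^p\psi(x)[h]^p|$. A $p$ times continuously differentiable $\psi$ has Lipschitz continuous $p$ derivative with constant $L_p^\psi$ if $\|D^p\psi(x)-D^p\psi(y)\|\le L_p^\psi\|x-y\|$ for all $x,y$ in its domain. Problem: $\min_{x\in\mathcal X} f(x)=\frac1N\sum_{i=1}^N f_i(x)$, where $f_i:\operatorname{dom} f\to\mathbb R$ are lower semicontinuous, $\operatorname{dom} f\subseteq E$ is open, and $\mathcal X\subseteq\operatorname{dom} f$ is closed and convex. Uniform convexity of degree $q\ge2$ with constant $\sigma_q>0$: $f(y)\ge f(x)+\langle f_x,y-x\rangle+\frac{\sigma_q}{q}\|x-y\|^q$ for all $x,y\in\operatorname{dom} f$ and every subgradient $f_x\in\partial f(x)$. Stochastic $p$ higher-order surrogate over $\mathcal X$: for every $\hat x=(x_1,\dots,x_N)\in\mathcal X^N$ there is $g(y;\hat x)=\frac1N\sum_{i=1}^N g_i(y;x_i)$, with $g_i(\cdot;x_i)$ real-valued on a domain containing $\mathcal X$, such that for all $i$: (i) $g_i(y;x_i)\ge f_i(y)$ for all $y\in\mathcal X$; (ii) the error function $h_i(y;x_i)=g_i(y;x_i)-f_i(y)$, with domain $E$, is $p$ times continuously differentiable with Lipschitz continuous $p$ derivative with constant $L_p^{h_i}$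 (not depending on $x_i$); (iii) $\nabla^j h_i(x_i;x_i)=0$ for $j=0,\dots,p$ ($j=0$ meaning $h_i(x_i;x_i)=0$). SHOM algorithm: given an integer $\tau\in[1,N]$, $p\ge1$ and $x_0\in\mathcal X$, set $x_0^j=x_0$ for all $j=1,\dots,N$ (equivalently $x_{-1}^j=x_0$). For $k\ge0$: choose uniformly at random (independently of the past) a subset $S_k\subseteq\{1,\dots,N\}$ of size $\tau$; set $x_k^j=x_k$ if $j\in S_k$ and $x_k^j=x_{k-1}^j$ if $j\notin S_k$; put $\hat x_k=(x_k^1,\dots,x_k^N)$; compute $x_{k+1}$ as a solution of $\min_{y\in\mathcal X} g(y;\hat x_k)$. *)

theory Defs
  imports "HOL-Probability.Probability"
begin

(* The class euclidean_space only supplies finite dimensionality and the topology of E.  The norm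
   of the setting is B_norm B, and the dual space is the type of bounded linear functionals. *)

definition self_adjoint_pd :: "('a::euclidean_space \<Rightarrow> 'a \<Rightarrow>\<^sub>L real) \<Rightarrow> bool" where
  "self_adjoint_pd B \<longleftrightarrow>
     linear B \<and>
     (\<forall>x y. blinfun_apply (B x) y = blinfun_apply (B y) x) \<and>
     (\<forall>x. x \<noteq> 0 \<longrightarrow> blinfun_apply (B x) x > 0)"

definition B_norm :: "('a::euclidean_space \<Rightarrow> 'a \<Rightarrow>\<^sub>L real) \<Rightarrow> 'a \<Rightarrow> real" where
  "B_norm B x = sqrt (blinfun_apply (B x) x)"

(* A j-linear form is represented by its values on lists of length j.  For a j times continuously
   differentiable psi and length hs = j, the number D_form psi hs x is D^j psi(x)[hs]. *)

primrec D_form :: "('a::euclidean_space \<Rightarrow> real) \<Rightarrow> 'a list \<Rightarrow> 'a \<Rightarrow> real" where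
  "D_form \<psi> [] = \<psi>"
| "D_form \<psi> (h # hs) = (\<lambda>x. frechet_derivative (D_form \<psi> hs) (at x) h)"

(* As E is finite-dimensional, differentiability and continuity of the form-valued map D^j psi
   amount to those of its components x |-> D^j psi(x)[hs]. *)

definition times_cont_differentiable :: "nat \<Rightarrow> ('a::euclidean_space \<Rightarrow> real) \<Rightarrow> bool" where
  "times_cont_differentiable p \<psi> \<longleftrightarrow>
     (\<forall>hs x. length hs < p \<longrightarrow> D_form \<psi> hs differentiable (at x)) \<and>
     (\<forall>hs. length hs \<le> p \<longrightarrow> continuous_on UNIV (D_form \<psi> hs))"

(* The supremum is a maximum for symmetric p-linear forms T, by compactness of the unit ball. *)

definition form_norm ::
    "('a::euclidean_space \<Rightarrow> 'a \<Rightarrow>\<^sub>L real) \<Rightarrow> nat \<Rightarrow> ('a list \<Rightarrow> real) \<Rightarrow> real" where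
  "form_norm B p T = (SUP h\<in>{h. B_norm B h \<le> 1}. \<bar>T (replicate p h)\<bar>)"

definition lipschitz_pth_derivative ::
    "('a::euclidean_space \<Rightarrow> 'a \<Rightarrow>\<^sub>L real) \<Rightarrow> nat \<Rightarrow> real \<Rightarrow> ('a \<Rightarrow> real) \<Rightarrow> bool" where
  "lipschitz_pth_derivative B p L \<psi> \<longleftrightarrow>
     times_cont_differentiable p \<psi> \<and>
     (\<forall>x y. form_norm B p (\<lambda>hs. D_form \<psi> hs x - D_form \<psi> hs y) \<le> L * B_norm B (x - y))"

definition lower_semicontinuous_on :: "'a::topological_space set \<Rightarrow> ('a \<Rightarrow> real) \<Rightarrow> bool" where
  "lower_semicontinuous_on D \<psi> \<longleftrightarrow>
     (\<forall>x\<in>D. \<forall>c. c < \<psi> x \<longrightarrow> (\<forall>\<^sub>F y in at x within D. c < \<psi> y))"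

definition subdifferential ::
    "'a::euclidean_space set \<Rightarrow> ('a \<Rightarrow> real) \<Rightarrow> 'a \<Rightarrow> ('a \<Rightarrow>\<^sub>L real) set" where
  "subdifferential D f x = {v. \<forall>y\<in>D. f y \<ge> f x + blinfun_apply v (y - x)}"

(* Convexity of f is part of uniform convexity: without it the inequality would be vacuous at the
   points where f has no subgradient. *)

definition uniformly_convex_on ::
    "('a::euclidean_space \<Rightarrow> 'a \<Rightarrow>\<^sub>L real) \<Rightarrow> real \<Rightarrow> real \<Rightarrow> 'a set \<Rightarrow> ('a \<Rightarrow> real) \<Rightarrow> bool" where
  "uniformly_convex_on B q \<sigma> D f \<longleftrightarrow>
     convex_on D f \<and>
     (\<forall>x\<in>D. \<forall>y\<in>D. \<forall>v\<in>subdifferential D f x.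
        f y \<ge> f x + blinfun_apply v (y - x) + \<sigma> / q * B_norm B (x - y) powr q)"

definition avg :: "nat \<Rightarrow> (nat \<Rightarrow> real) \<Rightarrow> real" where
  "avg N a = (\<Sum>j=1..N. a j) / real N"

(* g i y z stands for g_i(y; z), with domain G i z in y, and h i y z for the error h_i(y; z).  The
   error function has domain E and equals g_i - f_i wherever both terms are defined. *)

definition stochastic_surrogate ::
    "('a::euclidean_space \<Rightarrow> 'a \<Rightarrow>\<^sub>L real) \<Rightarrow> nat \<Rightarrow> nat \<Rightarrow> 'a set \<Rightarrow> 'a set \<Rightarrow> (nat \<Rightarrow> 'a \<Rightarrow> real)
      \<Rightarrow> (nat \<Rightarrow> 'a \<Rightarrow> 'a set) \<Rightarrow> (nat \<Rightarrow> 'a \<Rightarrow> 'a \<Rightarrow> real) \<Rightarrow> (nat \<Rightarrow> 'a \<Rightarrow> 'a \<Rightarrow> real)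
      \<Rightarrow> (nat \<Rightarrow> real) \<Rightarrow> bool" where
  "stochastic_surrogate B p N X D f G g h L \<longleftrightarrow>
     (\<forall>i\<in>{1..N}. \<forall>z\<in>X.
        X \<subseteq> G i z \<and>
        (\<forall>y\<in>X. g i y z \<ge> f i y) \<and>
        (\<forall>y\<in>G i z \<inter> D. h i y z = g i y z - f i y) \<and>
        lipschitz_pth_derivative B p (L i) (\<lambda>y. h i y z) \<and>
        (\<forall>vs. length vs \<le> p \<longrightarrow> D_form (\<lambda>y. h i y z) vs z = 0))"

(* shom_point S x k j is the point x_k^j kept for the j-th function.  At k = 0 both branches of the
   update give x_0, because x_{-1}^j = x_0. *)

primrec shom_point ::
    "(nat \<Rightarrow> 'w \<Rightarrow> nat set) \<Rightarrow> (nat \<Rightarrow> 'w \<Rightarrow> 'a) \<Rightarrow> nat \<Rightarrow> nat \<Rightarrow> 'w \<Rightarrow> 'a" where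
  "shom_point S x 0 j = x 0"
| "shom_point S x (Suc k) j =
     (\<lambda>\<omega>. if j \<in> S (Suc k) \<omega> then x (Suc k) \<omega> else shom_point S x k j \<omega>)"

(* the sigma-algebra generated by S_0, ..., S_k *)

definition history :: "'w measure \<Rightarrow> (nat \<Rightarrow> 'w \<Rightarrow> nat set) \<Rightarrow> nat \<Rightarrow> 'w measure" where
  "history M S k = sigma (space M) {S i -` A \<inter> space M | i A. i \<le> k}"

(* The solution x_{k+1} of the k-th subproblem need not be unique; any choice is allowed that is
   determined measurably by S_0, ..., S_k, i.e. one that does not look into the future. *)

locale shom = prob_space M for M :: "'w measure" +
  fixes N \<tau> :: nat
    and X :: "'a::euclidean_space set"
    and g :: "nat \<Rightarrow> 'a \<Rightarrow> 'a \<Rightarrow> real"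
    and x0 :: 'a
    and S :: "nat \<Rightarrow> 'w \<Rightarrow> nat set"
    and x :: "nat \<Rightarrow> 'w \<Rightarrow> 'a"
  assumes minibatch_size: "1 \<le> \<tau>" "\<tau> \<le> N"
    and start_feasible: "x0 \<in> X"
    and S_independent: "indep_vars (\<lambda>_. count_space UNIV) S UNIV"
    and S_uniform: "\<And>k. distr M (count_space UNIV) (S k) =
          measure_pmf (pmf_of_set {A. A \<subseteq> {1..N} \<and> card A = \<tau>})"
    and start: "\<And>\<omega>. \<omega> \<in> space M \<Longrightarrow> x 0 \<omega> = x0"
    and step: "\<And>k \<omega>. \<omega> \<in> space M \<Longrightarrow>
          is_arg_min (\<lambda>y. avg N (\<lambda>j. g j y (shom_point S x k j \<omega>))) (\<lambda>y. y \<in> X) (x (Suc k) \<omega>)"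
    and adapted: "\<And>k. x (Suc k) \<in> borel_measurable (history M S k)"

definition shom_W ::
    "('a::euclidean_space \<Rightarrow> 'a \<Rightarrow>\<^sub>L real) \<Rightarrow> nat \<Rightarrow> nat \<Rightarrow> (nat \<Rightarrow> 'w \<Rightarrow> nat set) \<Rightarrow> (nat \<Rightarrow> 'w \<Rightarrow> 'a)
      \<Rightarrow> 'a \<Rightarrow> nat \<Rightarrow> 'w \<Rightarrow> real" where
  "shom_W B p N S x xs k \<omega> = avg N (\<lambda>j. B_norm B (xs - shom_point S x k j \<omega>) ^ (p + 1))"

end

theory Submission
  imports Defs
begin

text \<open>Taylor's formula bounds each error function by
  \<open>L\<^sub>p\<^sup>h / (p+1)! \<cdot> \<parallel>y - x\<^sub>i\<parallel>\<^sup>p\<^sup>+\<^sup>1\<close>, so comparing the minimal surrogate value with its value at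
  \<open>x\<^sup>*\<close> gives \<open>f(x\<^sub>k\<^sub>+\<^sub>1) - f(x\<^sup>*) \<le> L\<^sub>p\<^sup>h / (p+1)! \<cdot> W\<^sub>k\<close>. A subgradient at
  \<open>x\<^sup>*\<close> that is nonnegative on feasible directions and uniform convexity turn this into the pointwise
  bound \<open>\<parallel>x\<^sub>k\<^sub>+\<^sub>1 - x\<^sup>*\<parallel>\<^sup>q \<le> C W\<^sub>k\<close>. As \<open>S\<^sub>k\<^sub>+\<^sub>1\<close> is independent of the past and contains each index
  with probability \<open>\<tau>/N\<close>, the conditional expectation of \<open>W\<^sub>k\<^sub>+\<^sub>1\<close> is exactly
  \<open>(1 - \<tau>/N) W\<^sub>k + \<tau>/N \<parallel>x\<^sub>k\<^sub>+\<^sub>1 - x\<^sup>*\<parallel>\<^sup>p\<^sup>+\<^sup>1\<close>. Near \<open>x\<^sup>*\<close> the pointwise bound also keeps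
  all iterates in the initial ball, which makes the contraction factor uniform.\<close>

section \<open>The norm of the setting\<close>

lemma B_norm_nonneg:
  assumes "self_adjoint_pd B" shows "0 \<le> B_norm B x"
proof (cases "x = 0")
  case True then show ?thesis by (simp add: B_norm_def)
next
  case False then show ?thesis using assms by (auto simp: B_norm_def self_adjoint_pd_def intro: less_imp_le)
qed

lemma B_norm_pos:
  assumes "self_adjoint_pd B" "x \<noteq> 0" shows "0 < B_norm B x"
  using assms by (auto simp: B_norm_def self_adjoint_pd_def)

lemma B_norm_scaleR:
  assumes "self_adjoint_pd B" shows "B_norm B (c *\<^sub>R x) = \<bar>c\<bar> * B_norm B x"
proof -
  have "B (c *\<^sub>R x) = c *\<^sub>R B x"
    using assms by (simp add: self_adjoint_pd_def linear_cmul)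
  then have "B_norm B (c *\<^sub>R x) = sqrt (c\<^sup>2 * blinfun_apply (B x) x)"
    by (simp add: B_norm_def blinfun.scaleR_left blinfun.scaleR_right power2_eq_square mult.assoc)
  then show ?thesis by (simp add: real_sqrt_mult B_norm_def)
qed

lemma B_norm_minus_commute:
  assumes "self_adjoint_pd B" shows "B_norm B (x - y) = B_norm B (y - x)"
  using B_norm_scaleR[OF assms, of "-1" "x - y"] by simp

lemma continuous_on_B_norm:
  assumes "self_adjoint_pd B" shows "continuous_on S (B_norm B)"
proof -
  have "bounded_linear B"
    using assms by (simp add: self_adjoint_pd_def linear_conv_bounded_linear)
  then have "continuous_on S B" by (rule linear_continuous_on)
  then show ?thesis
    unfolding B_norm_def by (intro continuous_intros)
qed

text \<open>By compactness the continuous function \<open>B_norm B\<close> attains a positive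
  minimum on the Euclidean unit sphere; homogeneity carries this minimum to all vectors. Hence the
  unit ball of \<open>B_norm B\<close> is bounded in the Euclidean norm.\<close>

lemma B_norm_dominates_norm:
  assumes "self_adjoint_pd (B :: 'a::euclidean_space \<Rightarrow> _)"
  obtains c where "c > 0" "\<And>x. c * norm x \<le> B_norm B x"
proof -
  let ?S = "sphere (0::'a) 1"
  obtain b :: 'a where "b \<in> Basis" by (meson nonempty_Basis ex_in_conv)
  then have "?S \<noteq> {}" by (auto intro!: exI[of _ b])
  then obtain u where u: "u \<in> ?S" "\<And>v. v \<in> ?S \<Longrightarrow> B_norm B u \<le> B_norm B v"
    using continuous_attains_inf[of ?S "B_norm B"] continuous_on_B_norm[OF assms] by auto
  show thesis
  proof (rule that[of "B_norm B u"])
    from u(1) have "u \<noteq> 0" by auto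
    then show "B_norm B u > 0" by (rule B_norm_pos[OF assms])
    fix x show "B_norm B u * norm x \<le> B_norm B x"
    proof (cases "x = 0")
      case True then show ?thesis by (simp add: B_norm_nonneg[OF assms])
    next
      case False
      have "B_norm B u * norm x \<le> B_norm B (inverse (norm x) *\<^sub>R x) * norm x"
        using False by (intro mult_right_mono u(2)) auto
      also have "\<dots> = B_norm B x"
        using False by (simp add: B_norm_scaleR[OF assms])
      finally show ?thesis .
    qed
  qed
qed

section \<open>The Taylor remainder\<close>

text \<open>The head of the list is differentiated last, so a suffix of directions can be absorbed
  into the function. This permits induction from the inner end of the list.\<close>

lemma D_form_append: "D_form \<psi> (hs @ ks) = D_form (D_form \<psi> ks) hs"
  by (induction hs) auto

text \<open>\<open>frechet_derivative\<close> is an arbitrary choice where no derivative exists, so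
  linearity in the function has to be earned by differentiability at every order below
  \<open>length hs\<close>.\<close>

lemma D_form_sum:
  assumes "finite A"
    and "\<And>b ks x. b \<in> A \<Longrightarrow> length ks < length hs \<Longrightarrow> D_form (\<phi> b) ks differentiable at x"
  shows "D_form (\<lambda>x. \<Sum>b\<in>A. c b * \<phi> b x) hs = (\<lambda>x. \<Sum>b\<in>A. c b * D_form (\<phi> b) hs x)"
  using assms(2)
proof (induction hs)
  case Nil then show ?case by simp
next
  case (Cons h hs)
  have IH: "D_form (\<lambda>x. \<Sum>b\<in>A. c b * \<phi> b x) hs = (\<lambda>x. \<Sum>b\<in>A. c b * D_form (\<phi> b) hs x)"
    by (rule Cons.IH) (simp add: Cons.prems)
  show ?case
  proof
    fix x
    have "((\<lambda>x. \<Sum>b\<in>A. c b * D_form (\<phi> b) hs x) has_derivative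
            (\<lambda>v. \<Sum>b\<in>A. c b * frechet_derivative (D_form (\<phi> b) hs) (at x) v)) (at x)"
    proof (intro has_derivative_sum has_derivative_mult_right)
      fix b assume "b \<in> A"
      then have "D_form (\<phi> b) hs differentiable at x" using Cons.prems by simp
      then show "(D_form (\<phi> b) hs has_derivative frechet_derivative (D_form (\<phi> b) hs) (at x)) (at x)"
        using frechet_derivative_works by blast
    qed
    from frechet_derivative_at[OF this, symmetric]
    show "D_form (\<lambda>x. \<Sum>b\<in>A. c b * \<phi> b x) (h # hs) x = (\<Sum>b\<in>A. c b * D_form (\<phi> b) (h # hs) x)"
      by (simp add: IH)
  qed
qed

text \<open>Each derivative is linear in its own direction and contributes one factor
  \<open>c\<close>. This homogeneity later moves bounds from the unit ball to arbitrary
  directions.\<close>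

lemma D_form_scaleR:
  assumes "\<And>ks x. length ks < length hs \<Longrightarrow> D_form \<psi> ks differentiable at x"
  shows "D_form \<psi> (map ((*\<^sub>R) c) hs) x = c ^ length hs * D_form \<psi> hs x"
  using assms
proof (induction hs arbitrary: x)
  case Nil then show ?case by simp
next
  case (Cons h hs)
  have "D_form \<psi> (map ((*\<^sub>R) c) hs) = (\<lambda>x. c ^ length hs * D_form \<psi> hs x)"
    by (rule ext, rule Cons.IH) (simp add: Cons.prems)
  moreover have diff: "D_form \<psi> hs differentiable at x" by (simp add: Cons.prems)
  moreover have "((\<lambda>x. c ^ length hs * D_form \<psi> hs x) has_derivative
      (\<lambda>v. c ^ length hs * frechet_derivative (D_form \<psi> hs) (at x) v)) (at x)"
    using diff by (intro has_derivative_mult_right) (simp add: frechet_derivative_works)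
  ultimately show ?case
    using frechet_derivative_at[symmetric]
    by (fastforce simp: linear_cmul[OF linear_frechet_derivative])
qed

text \<open>Expanding the innermost direction in the basis reduces the order by one without invoking the
  symmetry of the derivatives.\<close>
lemma D_form_bounded:
  fixes \<psi> :: "'a::euclidean_space \<Rightarrow> real"
  assumes "\<And>ks x. length ks < n \<Longrightarrow> D_form \<psi> ks differentiable at x"
  shows "\<exists>K\<ge>0. \<forall>hs. length hs = n \<longrightarrow> \<bar>D_form \<psi> hs x\<bar> \<le> K * (\<Prod>h\<leftarrow>hs. norm h)"
  using assms
proof (induction n arbitrary: \<psi>)
  case 0
  then show ?case by (auto intro!: exI[of _ "\<bar>\<psi> x\<bar>"])
next
  case (Suc n)
  have dif: "D_form (D_form \<psi> [b]) ks differentiable at y" if "length ks < n" for b ks y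
    using Suc.prems[of "ks @ [b]"] that by (simp add: D_form_append del: D_form.simps)
  then have "\<forall>b. \<exists>K\<ge>0. \<forall>hs. length hs = n \<longrightarrow>
      \<bar>D_form (D_form \<psi> [b]) hs x\<bar> \<le> K * (\<Prod>h\<leftarrow>hs. norm h)"
    using Suc.IH by blast
  then obtain K where K: "\<And>b. K b \<ge> 0"
      "\<And>b hs. length hs = n \<Longrightarrow> \<bar>D_form (D_form \<psi> [b]) hs x\<bar> \<le> K b * (\<Prod>h\<leftarrow>hs. norm h)"
    by metis
  show ?case
  proof (intro exI[of _ "\<Sum>b\<in>Basis. K b"] conjI allI impI)
    show "0 \<le> (\<Sum>b\<in>Basis. K b)" by (simp add: K sum_nonneg)
    fix hs :: "'a list" assume "length hs = Suc n"
    then obtain ks h where hs: "hs = ks @ [h]" "length ks = n"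
      by (metis length_Suc_conv_rev)
    have "D_form \<psi> [h] = (\<lambda>y. \<Sum>b\<in>Basis. (h \<bullet> b) * D_form \<psi> [b] y)"
    proof
      fix y
      have "linear (frechet_derivative \<psi> (at y))"
        using Suc.prems[of "[]" y] by (simp add: linear_frechet_derivative)
      then have "frechet_derivative \<psi> (at y) (\<Sum>b\<in>Basis. (h \<bullet> b) *\<^sub>R b)
          = (\<Sum>b\<in>Basis. (h \<bullet> b) * frechet_derivative \<psi> (at y) b)"
        by (simp add: linear_sum linear_cmul)
      then show "D_form \<psi> [h] y = (\<Sum>b\<in>Basis. (h \<bullet> b) * D_form \<psi> [b] y)"
        by (simp add: euclidean_representation)
    qed
    \<comment> \<open>The coefficients \<open>h \<bullet> b\<close> are constant in
      \<open>y\<close>, so the outer derivatives pass through the sum.\<close>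
    then have "D_form \<psi> hs x = D_form (\<lambda>y. \<Sum>b\<in>Basis. (h \<bullet> b) * D_form \<psi> [b] y) ks x"
      by (simp only: hs(1) D_form_append)
    also have "\<dots> = (\<Sum>b\<in>Basis. (h \<bullet> b) * D_form (D_form \<psi> [b]) ks x)"
      by (subst D_form_sum) (use dif hs in auto)
    also have "\<bar>\<dots>\<bar> \<le> (\<Sum>b\<in>Basis. \<bar>(h \<bullet> b) * D_form (D_form \<psi> [b]) ks x\<bar>)"
      by (rule sum_abs)
    also have "\<dots> \<le> (\<Sum>b\<in>Basis. norm h * (K b * (\<Prod>h\<leftarrow>ks. norm h)))"
      unfolding abs_mult using K(2)[OF hs(2)]
      by (intro sum_mono mult_mono) (auto simp: Basis_le_norm)
    also have "\<dots> = (\<Sum>b\<in>Basis. K b) * (\<Prod>h\<leftarrow>hs. norm h)"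
      by (simp add: hs(1) sum_distrib_left sum_distrib_right mult_ac)
    finally show "\<bar>D_form \<psi> hs x\<bar> \<le> (\<Sum>b\<in>Basis. K b) * (\<Prod>h\<leftarrow>hs. norm h)" .
  qed
qed

text \<open>\<open>form_norm\<close> is a real supremum and bounds its members only if the set is
  bounded above. The forms at \<open>x\<close> and \<open>y\<close> are bounded multilinear
  expressions, and the unit ball lies in a Euclidean ball of radius \<open>1 / c\<close>.\<close>

lemma form_norm_bdd_above:
  fixes \<psi> :: "'a::euclidean_space \<Rightarrow> real"
  assumes B: "self_adjoint_pd B" and \<psi>: "times_cont_differentiable p \<psi>"
  shows "bdd_above ((\<lambda>h. \<bar>D_form \<psi> (replicate p h) x - D_form \<psi> (replicate p h) y\<bar>) ` {h. B_norm B h \<le> 1})"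
proof -
  have dif: "\<And>ks x. length ks < p \<Longrightarrow> D_form \<psi> ks differentiable at x"
    using \<psi> by (simp add: times_cont_differentiable_def)
  obtain K where K: "K \<ge> 0" "\<And>hs. length hs = p \<Longrightarrow> \<bar>D_form \<psi> hs x\<bar> \<le> K * (\<Prod>h\<leftarrow>hs. norm h)"
    using D_form_bounded[of p \<psi> x] dif by blast
  obtain K' where K': "K' \<ge> 0" "\<And>hs. length hs = p \<Longrightarrow> \<bar>D_form \<psi> hs y\<bar> \<le> K' * (\<Prod>h\<leftarrow>hs. norm h)"
    using D_form_bounded[of p \<psi> y] dif by blast
  obtain c where c: "c > 0" "\<And>x. c * norm x \<le> B_norm B x"
    using B_norm_dominates_norm[OF B] by blast
  show ?thesis
  proof (rule bdd_aboveI2)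
    fix h assume "h \<in> {h. B_norm B h \<le> 1}"
    with c(2)[of h] c(1) have h: "norm h \<le> 1 / c" by (simp add: field_simps)
    have "\<bar>D_form \<psi> (replicate p h) x - D_form \<psi> (replicate p h) y\<bar> \<le> (K + K') * norm h ^ p"
      using K(2)[of "replicate p h"] K'(2)[of "replicate p h"]
      by (simp add: prod_list_replicate map_replicate algebra_simps)
    also have "\<dots> \<le> (K + K') * (1 / c) ^ p"
      using h K(1) K'(1) by (intro mult_left_mono power_mono) auto
    finally show "\<bar>D_form \<psi> (replicate p h) x - D_form \<psi> (replicate p h) y\<bar> \<le> (K + K') * (1 / c) ^ p" .
  qed
qed

text \<open>The supremum handles directions in the unit ball; homogeneity of degree \<open>p\<close>
  handles the others after normalisation.\<close>

lemma D_form_diff_le: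
  fixes \<psi> :: "'a::euclidean_space \<Rightarrow> real"
  assumes B: "self_adjoint_pd B" and L: "lipschitz_pth_derivative B p L \<psi>"
  shows "\<bar>D_form \<psi> (replicate p u) x - D_form \<psi> (replicate p u) y\<bar>
           \<le> L * B_norm B (x - y) * B_norm B u ^ p"
proof -
  have dif: "\<And>ks x. length ks < p \<Longrightarrow> D_form \<psi> ks differentiable at x"
    and \<psi>: "times_cont_differentiable p \<psi>"
    using L by (simp_all add: times_cont_differentiable_def lipschitz_pth_derivative_def)
  let ?T = "\<lambda>u. D_form \<psi> (replicate p u) x - D_form \<psi> (replicate p u) y"
  have unit: "\<bar>?T v\<bar> \<le> L * B_norm B (x - y)" if "B_norm B v \<le> 1" for v
  proof -
    have "\<bar>?T v\<bar> \<le> form_norm B p (\<lambda>hs. D_form \<psi> hs x - D_form \<psi> hs y)"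
      unfolding form_norm_def
      by (rule cSUP_upper) (use that form_norm_bdd_above[OF B \<psi>] in auto)
    also have "\<dots> \<le> L * B_norm B (x - y)"
      using L by (simp add: lipschitz_pth_derivative_def)
    finally show ?thesis .
  qed
  have hom: "?T (c *\<^sub>R v) = c ^ p * ?T v" for c v
    using D_form_scaleR[of "replicate p v" \<psi> c] dif by (simp add: right_diff_distrib)
  show ?thesis
  proof (cases "u = 0")
    case False
    define n where "n = B_norm B u"
    have n: "n > 0" using False B_norm_pos[OF B] by (simp add: n_def)
    have "\<bar>?T u\<bar> = \<bar>?T (n *\<^sub>R (inverse n *\<^sub>R u))\<bar>" using n by simp
    also have "\<dots> = n ^ p * \<bar>?T (inverse n *\<^sub>R u)\<bar>" using n by (simp only: hom abs_mult) simp
    also have "\<dots> \<le> n ^ p * (L * B_norm B (x - y))"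
      using n by (intro mult_left_mono unit) (auto simp: B_norm_scaleR[OF B] n_def)
    finally show ?thesis by (simp add: n_def mult_ac)
  next
    case True
    show ?thesis
    \<comment> \<open>The zero direction cannot be normalised. For \<open>p = 0\<close> the
      right-hand factor is \<open>0 ^ 0 = 1\<close>, so the unit bound is used; for positive
      \<open>p\<close> both sides vanish.\<close>
    proof (cases p)
      case 0
      then show ?thesis using unit[of 0] by (simp add: B_norm_def)
    next
      case (Suc m)
      then have "?T 0 = 0" using hom[of 0 0] by simp
      then show ?thesis using True Suc by (simp add: B_norm_def)
    qed
  qed
qed

text \<open>An absolute value is at most \<open>L\<close> times a positive number once the points
  \<open>b\<close>, \<open>0\<close> and the direction \<open>b\<close> are inserted, for a basis
  vector \<open>b\<close>.\<close>

lemma lipschitz_pth_derivative_nonneg: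
  fixes \<psi> :: "'a::euclidean_space \<Rightarrow> real"
  assumes B: "self_adjoint_pd B" and L: "lipschitz_pth_derivative B p L \<psi>"
  shows "L \<ge> 0"
proof -
  obtain b :: 'a where "b \<in> Basis" by (meson nonempty_Basis ex_in_conv)
  then have b: "B_norm B b > 0" by (intro B_norm_pos[OF B]) auto
  have "0 \<le> L * (B_norm B b * B_norm B b ^ p)"
    using D_form_diff_le[OF B L, of b b 0] by (simp add: mult.assoc)
  moreover have "0 < B_norm B b * B_norm B b ^ p" using b by simp
  ultimately show ?thesis by (simp add: zero_le_mult_iff)
qed

text \<open>Chain rule along the line through \<open>z\<close> with direction \<open>u\<close>: each
  derivative in \<open>t\<close> puts one more \<open>u\<close> at the front of the list.\<close>

lemma D_form_along_line_has_derivative: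
  assumes "\<And>y. D_form \<psi> (replicate n u) differentiable at y"
  shows "((\<lambda>t. D_form \<psi> (replicate n u) (z + t *\<^sub>R u)) has_real_derivative
          D_form \<psi> (replicate (Suc n) u) (z + t *\<^sub>R u)) (at t)"
proof -
  let ?F = "D_form \<psi> (replicate n u)" and ?y = "z + t *\<^sub>R u"
  have F: "(?F has_derivative frechet_derivative ?F (at ?y)) (at ?y)"
    using assms frechet_derivative_works by blast
  have "((\<lambda>t. z + t *\<^sub>R u) has_derivative (\<lambda>s. s *\<^sub>R u)) (at t)"
    by (auto intro!: derivative_eq_intros)
  from has_derivative_compose[OF this F]
  have "((\<lambda>t. ?F (z + t *\<^sub>R u)) has_derivative (\<lambda>s. frechet_derivative ?F (at ?y) (s *\<^sub>R u))) (at t)" .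
  also have "(\<lambda>s. frechet_derivative ?F (at ?y) (s *\<^sub>R u)) = (*) (D_form \<psi> (replicate (Suc n) u) ?y)"
    using linear_frechet_derivative[OF assms] by (auto simp: linear_cmul)
  finally show ?thesis by (simp add: has_field_derivative_def)
qed

text \<open>The Taylor polynomial at \<open>z\<close> vanishes, so only the remainder is left. It is
  estimated on the segment from \<open>z\<close> to \<open>y\<close> by integrating the Lipschitz
  bound on the derivative of order \<open>p\<close> in total \<open>p\<close> times.\<close>

lemma lipschitz_pth_derivative_remainder:
  fixes \<psi> :: "'a::euclidean_space \<Rightarrow> real"
  assumes B: "self_adjoint_pd B" and L: "lipschitz_pth_derivative B p L \<psi>"
    and zero: "\<And>vs. length vs \<le> p \<Longrightarrow> D_form \<psi> vs z = 0"
  shows "\<psi> y \<le> L / fact (p + 1) * B_norm B (y - z) ^ (p + 1)"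
proof -
  define u where "u = y - z"
  \<comment> \<open>Along the segment, the Lipschitz bound at distance
    \<open>t * B_norm B u\<close>, applied to \<open>p\<close> copies of \<open>u\<close>, is
    exactly \<open>A * t\<close>.\<close>
  define A where "A = L * B_norm B u ^ (p + 1)"
  define F where "F n t = D_form \<psi> (replicate n u) (z + t *\<^sub>R u)" for n t
  have dif: "D_form \<psi> (replicate n u) differentiable at x" if "n < p" for n x
    using L that by (simp add: times_cont_differentiable_def lipschitz_pth_derivative_def)
  \<comment> \<open>\<open>m\<close> counts the integrations already done: the order of the
    derivative falls from \<open>p\<close> while the power of \<open>t\<close> rises from 1.\<close>
  have "F (p - m) t \<le> A * t ^ (m + 1) / fact (m + 1)" if "m \<le> p" "0 \<le> t" for m t
    using that
  proof (induction m arbitrary: t)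
    case 0
    have "F p t \<le> L * B_norm B (t *\<^sub>R u) * B_norm B u ^ p"
      using D_form_diff_le[OF B L, of u "z + t *\<^sub>R u" z] zero[of "replicate p u"]
      by (simp add: F_def)
    then show ?case using 0 by (simp add: B_norm_scaleR[OF B] A_def mult_ac)
  next
    case (Suc m)
    define n where "n = p - Suc m"
    have n: "n < p" "Suc n = p - m" using Suc.prems by (auto simp: n_def)
    \<comment> \<open>Integration is replaced by monotonicity: bound minus \<open>F n\<close> has a
      nonnegative derivative by the induction hypothesis, and it is zero at
      \<open>t = 0\<close>.\<close>
    have "A * 0 ^ (m + 2) / fact (m + 2) - F n 0 \<le> A * t ^ (m + 2) / fact (m + 2) - F n t"
    proof (rule DERIV_nonneg_imp_nondecreasing[OF Suc.prems(2)])
      fix s :: real assume s: "0 \<le> s" "s \<le> t"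
      have "(F n has_real_derivative F (Suc n) s) (at s)"
        unfolding F_def by (rule D_form_along_line_has_derivative) (rule dif[OF n(1)])
      moreover have "((\<lambda>t. A * t ^ (m + 2) / fact (m + 2)) has_real_derivative
                        A * s ^ (m + 1) / fact (m + 1)) (at s)"
        using DERIV_cdivide[OF DERIV_cmult[OF DERIV_pow[of "m + 2" s UNIV], of A], of "fact (m + 2)"]
        by (simp del: of_nat_Suc)
      ultimately have "((\<lambda>t. A * t ^ (m + 2) / fact (m + 2) - F n t) has_real_derivative
                        A * s ^ (m + 1) / fact (m + 1) - F (Suc n) s) (at s)"
        by (rule DERIV_diff[rotated])
      moreover have "F (Suc n) s \<le> A * s ^ (m + 1) / fact (m + 1)"
        using Suc.IH[of s] Suc.prems s by (simp add: n(2))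
      ultimately show "\<exists>d. ((\<lambda>t. A * t ^ (m + 2) / fact (m + 2) - F n t) has_real_derivative d) (at s) \<and> 0 \<le> d"
        by (meson diff_ge_0_iff_ge)
    qed
    moreover have "F n 0 = 0" using zero[of "replicate n u"] n by (simp add: F_def)
    ultimately show ?case by (simp add: n_def)
  qed
  from this[of p 1] show ?thesis by (simp add: F_def A_def u_def)
qed

section \<open>Growth at a constrained minimizer\<close>

text \<open>Separate \<open>X \<times> {..0}\<close> from the strict epigraph of \<open>F - F xs\<close>; the hyperplane is not vertical
  because \<open>xs\<close> is interior to \<open>D\<close>.\<close>
lemma convex_minimizer_subgradient:
  fixes F :: "'a::euclidean_space \<Rightarrow> real"
  assumes D: "open D" "convex_on D F" and X: "X \<subseteq> D" "convex X"
    and min: "xs \<in> X" "\<And>y. y \<in> X \<Longrightarrow> F xs \<le> F y"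
  obtains v where "v \<in> subdifferential D F xs" "\<And>y. y \<in> X \<Longrightarrow> 0 \<le> blinfun_apply v (y - xs)"
proof -
  have xsD: "xs \<in> D" using min X by auto
  let ?P = "X \<times> {..0::real}"
  let ?Q = "{(y, t). y \<in> D \<and> F y - F xs < t}"
  have "convex ?Q"
  proof (rule convexI)
    fix a b and u v :: real
    assume ab: "a \<in> ?Q" "b \<in> ?Q" and uv: "0 \<le> u" "0 \<le> v" "u + v = 1"
    obtain y s z t where eq: "a = (y, s)" "b = (z, t)" by (metis surj_pair)
    have "u *\<^sub>R y + v *\<^sub>R z \<in> D"
      using D(2) ab uv by (auto simp: eq convex_on_def intro: convexD)
    moreover have "F (u *\<^sub>R y + v *\<^sub>R z) \<le> u * F y + v * F z"
      using D(2) ab uv by (auto simp: eq convex_on_def)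
    \<comment> \<open>A strict inequality survives multiplication only by a positive weight, hence
      the separate case \<open>u = 0\<close>, where \<open>v = 1\<close>.\<close>
    moreover have "u * (F y - F xs) + v * (F z - F xs) < u * s + v * t"
    proof (cases "u = 0")
      case False
      with uv ab have "u * (F y - F xs) < u * s" "v * (F z - F xs) \<le> v * t"
        by (auto simp: eq intro!: mult_left_mono)
      then show ?thesis by simp
    qed (use ab uv in \<open>auto simp: eq\<close>)
    moreover have "u * F xs + v * F xs = F xs"
      using uv(3) by (simp add: distrib_right[symmetric])
    ultimately show "u *\<^sub>R a + v *\<^sub>R b \<in> ?Q"
      by (simp add: eq right_diff_distrib)
  qed
  moreover have "convex ?P" using X by (intro convex_Times) auto
  moreover have "?P \<inter> ?Q = {}" using min by force
  moreover have "(xs, 0) \<in> ?P" "(xs, 1) \<in> ?Q" using min(1) xsD by auto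
  ultimately obtain a b where ab: "a \<noteq> 0" "\<And>w. w \<in> ?P \<Longrightarrow> a \<bullet> w \<le> b" "\<And>w. w \<in> ?Q \<Longrightarrow> a \<bullet> w \<ge> b"
    using separating_hyperplane_sets[of ?P ?Q] by blast
  obtain u s where a: "a = (u, s)" by fastforce
  have P: "u \<bullet> y \<le> b" if "y \<in> X" for y using ab(2)[of "(y, 0)"] that by (simp add: a)
  have Q: "b \<le> u \<bullet> y + s * t" if "y \<in> D" "F y - F xs < t" for y t
    using ab(3)[of "(y, t)"] that by (simp add: a)
  \<comment> \<open>\<open>(xs, 0)\<close> and \<open>(xs, 1)\<close> lie on one vertical line, on
    opposite sides of the hyperplane.\<close>
  have "s \<ge> 0" using P[OF min(1)] Q[of xs 1] xsD by simp
  moreover have "s \<noteq> 0"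
  proof
    assume "s = 0"
    then have u: "u \<noteq> 0" using ab(1) a by (simp add: zero_prod_def)
    obtain e where e: "e > 0" "ball xs e \<subseteq> D" using D(1) xsD openE by blast
    \<comment> \<open>A step of length \<open>e / 2\<close> against \<open>u\<close> stays in
      \<open>D\<close> and strictly lowers \<open>u \<bullet> y\<close>, which a vertical hyperplane
      forbids.\<close>
    define y where "y = xs - (e / (2 * norm u)) *\<^sub>R u"
    have "dist xs y < e" using e u by (simp add: y_def dist_norm)
    then have "b \<le> u \<bullet> y" using Q[of y "F y - F xs + 1"] e \<open>s = 0\<close> by auto
    also have "u \<bullet> y < u \<bullet> xs"
      using e u by (simp add: y_def inner_diff_right)
    finally show False using P[OF min(1)] by simp
  qed
  ultimately have s: "s > 0" by simp
  \<comment> \<open>The strict epigraph is closed up: a height slack of \<open>e / s\<close> costs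
    exactly \<open>e\<close> on the right, and \<open>e\<close> is arbitrary.\<close>
  have Q': "b \<le> u \<bullet> y + s * (F y - F xs)" if "y \<in> D" for y
  proof (rule field_le_epsilon)
    fix e :: real assume "e > 0"
    then show "b \<le> u \<bullet> y + s * (F y - F xs) + e"
      using Q[OF that, of "F y - F xs + e / s"] s by (simp add: distrib_left)
  qed
  have b: "b = u \<bullet> xs" using P[OF min(1)] Q'[OF xsD] by simp
  \<comment> \<open>Solving the hyperplane equation for the height gives this slope. Since
    \<open>b = u \<bullet> xs\<close>, the side containing \<open>X\<close> becomes nonnegativity on
    feasible directions.\<close>
  let ?v = "blinfun_inner_right (- u /\<^sub>R s)"
  show thesis
  proof (rule that[of ?v])
    show "?v \<in> subdifferential D F xs"
      using Q' s by (auto simp: subdifferential_def b inner_diff_right field_simps)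
    show "0 \<le> blinfun_apply ?v (y - xs)" if "y \<in> X" for y
      using P[OF that] s by (simp add: b inner_diff_right field_simps)
  qed
qed

lemma uniformly_convex_on_growth:
  fixes F :: "'a::euclidean_space \<Rightarrow> real"
  assumes "open D" "X \<subseteq> D" "convex X" "uniformly_convex_on B q \<sigma> D F"
    and "is_arg_min F (\<lambda>y. y \<in> X) xs" "y \<in> X"
  shows "\<sigma> / q * B_norm B (xs - y) powr q \<le> F y - F xs"
proof -
  obtain v where v: "v \<in> subdifferential D F xs" "0 \<le> blinfun_apply v (y - xs)"
    using convex_minimizer_subgradient[of D F X xs] assms
    unfolding is_arg_min_def uniformly_convex_on_def by (metis not_less)
  have "F xs + blinfun_apply v (y - xs) + \<sigma> / q * B_norm B (xs - y) powr q \<le> F y"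
    using assms v(1) unfolding uniformly_convex_on_def is_arg_min_def by blast
  then show ?thesis using v(2) by simp
qed

section \<open>Averages and the deterministic estimate for one step\<close>

lemma avg_mono: "(\<And>j. j \<in> {1..N} \<Longrightarrow> a j \<le> b j) \<Longrightarrow> avg N a \<le> avg N b"
  unfolding avg_def by (intro divide_right_mono sum_mono) auto

lemma avg_nonneg: "(\<And>j. j \<in> {1..N} \<Longrightarrow> 0 \<le> a j) \<Longrightarrow> 0 \<le> avg N a"
  unfolding avg_def by (intro divide_nonneg_nonneg sum_nonneg) auto

lemma avg_add: "avg N (\<lambda>j. a j + b j) = avg N a + avg N b"
  by (simp add: avg_def sum.distrib add_divide_distrib)

lemma avg_mult_left: "avg N (\<lambda>j. c * a j) = c * avg N a"
  by (simp add: avg_def sum_distrib_left)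

lemma avg_const: "N \<noteq> 0 \<Longrightarrow> avg N (\<lambda>j. c) = c"
  by (simp add: avg_def)

text \<open>For arbitrary reference points in \<open>X\<close>, the chain is: objective at
  \<open>y\<close>, surrogate at \<open>y\<close>, surrogate at \<open>xs\<close>, objective at
  \<open>xs\<close> plus the Taylor remainder. Growth at \<open>xs\<close> bounds the resulting gap
  from below.\<close>

lemma surrogate_minimizer_dist:
  fixes B :: "'a::euclidean_space \<Rightarrow> 'a \<Rightarrow>\<^sub>L real"
  assumes B: "self_adjoint_pd B"
    and D: "open D" and X: "X \<subseteq> D" "convex X" and q: "q > 0" and \<sigma>: "\<sigma> > 0"
    and uc: "uniformly_convex_on B q \<sigma> D (\<lambda>y. avg N (\<lambda>i. f i y))"
    and sur: "stochastic_surrogate B p N X D f G g h (\<lambda>_. L)"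
    and xs: "is_arg_min (\<lambda>y. avg N (\<lambda>i. f i y)) (\<lambda>y. y \<in> X) xs"
    and z: "\<And>j. j \<in> {1..N} \<Longrightarrow> z j \<in> X"
    and y: "is_arg_min (\<lambda>y. avg N (\<lambda>j. g j y (z j))) (\<lambda>y. y \<in> X) y"
  shows "B_norm B (xs - y) powr q
           \<le> L * q / (\<sigma> * fact (p + 1)) * avg N (\<lambda>j. B_norm B (xs - z j) ^ (p + 1))"
proof -
  let ?W = "avg N (\<lambda>j. B_norm B (xs - z j) ^ (p + 1))"
  have X': "xs \<in> X" "y \<in> X" using xs y by (auto simp: is_arg_min_def)
  have "avg N (\<lambda>i. f i y) \<le> avg N (\<lambda>j. g j y (z j))"
    using sur z X' by (intro avg_mono) (auto simp: stochastic_surrogate_def)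
  also have "\<dots> \<le> avg N (\<lambda>j. g j xs (z j))"
    using y X' by (auto simp: is_arg_min_def not_less)
  also have "\<dots> \<le> avg N (\<lambda>j. f j xs + L / fact (p + 1) * B_norm B (xs - z j) ^ (p + 1))"
  proof (rule avg_mono)
    fix j assume j: "j \<in> {1..N}"
    have "X \<subseteq> G j (z j)" using sur z[OF j] j unfolding stochastic_surrogate_def by blast
    \<comment> \<open>The identity between error function and \<open>g - f\<close> is available only
      on the common domain.\<close>
    then have mem: "xs \<in> G j (z j) \<inter> D" using X' X by auto
    have "h j xs (z j) \<le> L / fact (p + 1) * B_norm B (xs - z j) ^ (p + 1)"
      using sur z[OF j] j
      by (intro lipschitz_pth_derivative_remainder[OF B]) (auto simp: stochastic_surrogate_def)
    moreover have "h j xs (z j) = g j xs (z j) - f j xs"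
      using sur z[OF j] j mem unfolding stochastic_surrogate_def by blast
    ultimately show "g j xs (z j) \<le> f j xs + L / fact (p + 1) * B_norm B (xs - z j) ^ (p + 1)"
      by simp
  qed
  also have "\<dots> = avg N (\<lambda>i. f i xs) + L / fact (p + 1) * ?W"
    by (simp only: avg_add avg_mult_left)
  finally have "\<sigma> / q * B_norm B (xs - y) powr q \<le> L / fact (p + 1) * ?W"
    using uniformly_convex_on_growth[OF D X uc xs X'(2)] by simp
  then have "q / \<sigma> * (\<sigma> / q * B_norm B (xs - y) powr q) \<le> q / \<sigma> * (L / fact (p + 1) * ?W)"
    using q \<sigma> by (intro mult_left_mono) auto
  then show ?thesis using q \<sigma> by (simp add: mult_ac)
qed

text \<open>Raise the hypothesis to the power \<open>(p + 1) / q\<close> and split off one factor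
  \<open>w\<close>, which exposes the contraction factor. The remaining exponent of \<open>w\<close>
  may be negative, so \<open>a = 0\<close> is treated apart; otherwise \<open>w\<close> is
  positive.\<close>

lemma power_le_of_powr_le:
  assumes "0 \<le> a" "0 \<le> C" "0 \<le> w" "0 < q" "a powr q \<le> C * w"
  shows "a ^ (p + 1) \<le> C powr ((real p + 1) / q) * w powr ((real p + 1 - q) / q) * w"
proof (cases "a = 0")
  case True
  then show ?thesis using assms by simp
next
  case False
  with assms have a: "a > 0" by simp
  have "w \<noteq> 0" using assms(5) a by (auto simp: not_le)
  with assms have w: "w > 0" by simp
  have "a ^ (p + 1) = (a powr q) powr ((real p + 1) / q)"
    using a assms(4) by (simp add: powr_powr powr_add powr_realpow mult.commute)
  also have "\<dots> \<le> (C * w) powr ((real p + 1) / q)"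
    using assms by (intro powr_mono2) auto
  also have "\<dots> = C powr ((real p + 1) / q) * w powr ((real p + 1) / q)"
    using assms by (simp add: powr_mult)
  also have "(real p + 1) / q = (real p + 1 - q) / q + 1"
    using assms(4) by (simp add: field_simps)
  also have "w powr ((real p + 1 - q) / q + 1) = w powr ((real p + 1 - q) / q) * w"
    using w by (simp add: powr_add)
  finally show ?thesis using assms(4) by (simp add: field_simps)
qed

section \<open>Conditioning on the past minibatches\<close>

lemma space_history [simp]: "space (history M S k) = space M"
  by (simp add: history_def space_measure_of_conv)

lemma sets_history:
  "sets (history M S k) = sigma_sets (space M) {S i -` A \<inter> space M | i A. i \<le> k}"
  unfolding history_def by (rule sets_measure_of) auto

lemma subalgebra_history:
  assumes "\<And>i. S i \<in> measurable M (count_space UNIV)"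
  shows "subalgebra M (history M S k)"
proof -
  have "{S i -` A \<inter> space M | i A. i \<le> k} \<subseteq> sets M"
    using measurable_sets[OF assms] by auto
  then show ?thesis
    unfolding subalgebra_def sets_history space_history by (simp add: sets.sigma_sets_subset)
qed

lemma vimage_in_history: "i \<le> k \<Longrightarrow> S i -` A \<inter> space M \<in> sets (history M S k)"
  unfolding sets_history by (rule sigma_sets.Basic) blast

lemma sets_history_mono:
  assumes "k \<le> l" shows "sets (history M S k) \<subseteq> sets (history M S l)"
  unfolding sets_history by (rule sigma_sets_mono', rule Collect_mono) (blast intro: order.trans[OF _ assms])

lemma borel_measurable_history_mono:
  assumes "u \<in> borel_measurable (history M S k)" "k \<le> l"
  shows "u \<in> borel_measurable (history M S l)"
  using assms sets_history_mono[OF assms(2), of M S] by (auto simp: measurable_def)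

text \<open>Grouping an independent family into disjoint index blocks gives independent
  sigma-algebras. The preimages under one \<open>S i\<close> form the required intersection-stable
  generators.\<close>

lemma (in prob_space) history_indep_next:
  assumes ind: "indep_vars (\<lambda>_. count_space UNIV) S UNIV"
    and A: "A \<in> sets (history M S k)"
  shows "prob (A \<inter> (S (Suc k) -` T \<inter> space M)) = prob A * prob (S (Suc k) -` T \<inter> space M)"
proof -
  define E where "E i = {S i -` A \<inter> space M | A. True}" for i
  \<comment> \<open>\<open>True\<close> labels the block of past minibatches, \<open>False\<close>
    the next one.\<close>
  let ?I = "case_bool {..k} {Suc k}"
  have E: "indep_sets E UNIV"
    using ind unfolding indep_vars_def2 E_def by simp
  have ind2: "indep_sets (\<lambda>j. sigma_sets (space M) (\<Union>i\<in>?I j. E i)) UNIV"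
  proof (rule indep_sets_collect_sigma)
    show "indep_sets E (\<Union>j\<in>UNIV. ?I j)" by (rule indep_sets_mono_index[OF _ E]) simp
    show "disjoint_family_on ?I UNIV"
      by (auto simp: disjoint_family_on_def split: bool.split)
    show "Int_stable (E i)" for i
      unfolding Int_stable_def E_def
    proof clarsimp
      fix A A'
      show "\<exists>C. S i -` A \<inter> space M \<inter> (S i -` A' \<inter> space M) = S i -` C \<inter> space M"
        by (rule exI[of _ "A \<inter> A'"]) auto
    qed
  qed
  have gen: "{S i -` A \<inter> space M | i A. i \<le> k} = (\<Union>i\<in>{..k}. E i)"
    by (auto simp: E_def)
  have "A \<in> sigma_sets (space M) (\<Union>i\<in>?I True. E i)"
    using A unfolding sets_history gen by simp
  moreover have "S (Suc k) -` T \<inter> space M \<in> sigma_sets (space M) (\<Union>i\<in>?I False. E i)"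
    by (rule sigma_sets.Basic) (auto simp: E_def)
  ultimately have "prob (\<Inter>j\<in>UNIV. case_bool A (S (Suc k) -` T \<inter> space M) j)
      = (\<Prod>j\<in>UNIV. prob (case_bool A (S (Suc k) -` T \<inter> space M) j))"
    by (intro indep_setsD[OF ind2]) (auto split: bool.split)
  then show ?thesis by (simp add: UNIV_bool ac_simps)
qed

text \<open>Deleting \<open>j\<close> matches the favourable sets with the subsets of size
  \<open>\<tau> - 1\<close> of the other \<open>N - 1\<close> indices; the absorption identity for
  binomial coefficients then gives the ratio.\<close>

lemma prob_uniform_subset_mem:
  assumes "j \<in> {1..N}" "1 \<le> \<tau>" "\<tau> \<le> N"
  shows "measure (measure_pmf (pmf_of_set {A. A \<subseteq> {1..N} \<and> card A = \<tau>})) {A. j \<in> A} = real \<tau> / real N"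
proof -
  let ?P = "{A. A \<subseteq> {1..N} \<and> card A = \<tau>}"
  have fin: "finite ?P" by (rule finite_subset[of _ "Pow {1..N}"]) (blast, simp)
  have cP: "card ?P = N choose \<tau>" using n_subsets[of "{1..N}" \<tau>] by simp
  moreover have "0 < N choose \<tau>" using assms(3) by simp
  ultimately have ne: "?P \<noteq> {}" using card_gt_0_iff[of ?P] by argo
  have "bij_betw (insert j) {A. A \<subseteq> {1..N} - {j} \<and> card A = \<tau> - 1} (?P \<inter> {A. j \<in> A})"
  proof (rule bij_betw_byWitness[where f' = "\<lambda>A. A - {j}"])
    show "insert j ` {A. A \<subseteq> {1..N} - {j} \<and> card A = \<tau> - 1} \<subseteq> ?P \<inter> {A. j \<in> A}"
    proof clarify
      fix A assume A: "A \<subseteq> {1..N} - {j}" "card A = \<tau> - 1"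
      then have "finite A" "j \<notin> A" using finite_subset[OF A(1)] by auto
      then show "insert j A \<in> ?P \<inter> {A. j \<in> A}" using A assms by auto
    qed
    show "(\<lambda>A. A - {j}) ` (?P \<inter> {A. j \<in> A}) \<subseteq> {A. A \<subseteq> {1..N} - {j} \<and> card A = \<tau> - 1}"
    proof clarify
      fix A assume "A \<subseteq> {1..N}" "j \<in> A" "\<tau> = card A"
      then show "A - {j} \<subseteq> {1..N} - {j} \<and> card (A - {j}) = card A - 1"
        by (simp only: card_Diff_singleton) blast
    qed
    show "\<forall>A\<in>{A. A \<subseteq> {1..N} - {j} \<and> card A = \<tau> - 1}. insert j A - {j} = A" by blast
    show "\<forall>A\<in>?P \<inter> {A. j \<in> A}. insert j (A - {j}) = A" by blast
  qed
  then have "card (?P \<inter> {A. j \<in> A}) = card {A. A \<subseteq> {1..N} - {j} \<and> card A = \<tau> - 1}"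
    by (rule bij_betw_same_card[symmetric])
  also have "\<dots> = (N - 1) choose (\<tau> - 1)"
    using n_subsets[of "{1..N} - {j}" "\<tau> - 1"] assms(1) by simp
  finally have c: "card (?P \<inter> {A. j \<in> A}) = (N - 1) choose (\<tau> - 1)" .
  have "real \<tau> * real (N choose \<tau>) = real N * real ((N - 1) choose (\<tau> - 1))"
    using times_binomial_minus1_eq[of \<tau> N] assms(2) unfolding of_nat_mult[symmetric] by simp
  moreover have "real (N choose \<tau>) > 0" "real N > 0" using assms by auto
  ultimately have "real ((N - 1) choose (\<tau> - 1)) / real (N choose \<tau>) = real \<tau> / real N"
    by (simp add: field_simps)
  then show ?thesis
    unfolding measure_pmf_of_set[OF ne fin] c cP .
qed

text \<open>Known factors come out of the conditional expectation, and an event independent of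
  \<open>F\<close> contributes its probability. The events may depend on one another, as membership
  of different indices in one minibatch does: linearity treats them one at a time.\<close>

lemma (in prob_space) real_cond_exp_sum_indep_indicators:
  assumes sub: "subalgebra M F"
    and u: "\<And>j. u j \<in> borel_measurable F" "\<And>j \<omega>. \<omega> \<in> space M \<Longrightarrow> \<bar>u j \<omega>\<bar> \<le> K"
    and E: "\<And>j. E j \<in> events" "\<And>j A. A \<in> sets F \<Longrightarrow> prob (A \<inter> E j) = prob A * prob (E j)"
  shows "AE \<omega> in M. real_cond_exp M F (\<lambda>\<omega>. \<Sum>j\<in>I. u j \<omega> * indicator (E j) \<omega>) \<omega>
           = (\<Sum>j\<in>I. u j \<omega> * prob (E j))"
proof (cases "finite I")
  case True
  interpret finite_measure_subalgebra M F by unfold_locales (rule sub)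
  have FM: "A \<in> sets F \<Longrightarrow> A \<in> events" for A using sub by (auto simp: subalgebra_def)
  have uM [measurable]: "u j \<in> borel_measurable M" for j
    by (rule measurable_from_subalg[OF sub u(1)])
  have [measurable]: "E j \<in> events" for j by (rule E)
  have int: "integrable M (\<lambda>\<omega>. u j \<omega> * indicator (E j) \<omega>)" for j
  proof (rule integrable_const_bound[of _ "\<bar>K\<bar>"])
    show "AE \<omega> in M. norm (u j \<omega> * indicator (E j) \<omega>) \<le> \<bar>K\<bar>"
    proof (rule AE_I2)
      fix \<omega> assume "\<omega> \<in> space M"
      from u(2)[OF this, of j] show "norm (u j \<omega> * indicator (E j) \<omega>) \<le> \<bar>K\<bar>"
        by (auto simp: indicator_def)
    qed
  qed measurable
  have ind: "AE \<omega> in M. real_cond_exp M F (indicator (E j)) \<omega> = prob (E j)" for j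
  proof (rule real_cond_exp_charact)
    fix A assume A: "A \<in> sets F"
    note [measurable] = FM[OF A]
    show "(\<integral>\<omega>\<in>A. indicator (E j) \<omega> \<partial>M) = (\<integral>\<omega>\<in>A. prob (E j) \<partial>M)"
      using E(2)[OF A, of j]
      by (simp add: set_lebesgue_integral_def indicator_inter_arith[symmetric] mult.commute)
  qed (simp_all add: integrable_real_indicator emeasure_eq_measure)
  have "AE \<omega> in M. real_cond_exp M F (\<lambda>\<omega>. u j \<omega> * indicator (E j) \<omega>) \<omega> = u j \<omega> * prob (E j)" for j
  proof -
    have "AE \<omega> in M. real_cond_exp M F (\<lambda>\<omega>. u j \<omega> * indicator (E j) \<omega>) \<omega>
            = u j \<omega> * real_cond_exp M F (indicator (E j)) \<omega>"
      by (rule real_cond_exp_mult[OF u(1) _ int]) simp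
    then show ?thesis using ind[of j] by eventually_elim simp
  qed
  then have "AE \<omega> in M. \<forall>j\<in>I. real_cond_exp M F (\<lambda>\<omega>. u j \<omega> * indicator (E j) \<omega>) \<omega> = u j \<omega> * prob (E j)"
    using True by (intro AE_finite_allI) auto
  moreover have "AE \<omega> in M. real_cond_exp M F (\<lambda>\<omega>. \<Sum>j\<in>I. u j \<omega> * indicator (E j) \<omega>) \<omega>
      = (\<Sum>j\<in>I. real_cond_exp M F (\<lambda>\<omega>. u j \<omega> * indicator (E j) \<omega>) \<omega>)"
    by (rule real_cond_exp_sum) (rule int)
  ultimately show ?thesis by eventually_elim simp
next
  \<comment> \<open>A sum over an infinite index set is 0 by convention, so both sides
    vanish.\<close>
  case False
  interpret finite_measure_subalgebra M F by unfold_locales (rule sub)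
  have "AE \<omega> in M. real_cond_exp M F (\<lambda>_. 0) \<omega> = 0" by (rule real_cond_exp_F_meas) auto
  then show ?thesis using False by simp
qed

section \<open>Convergence of SHOM\<close>

text \<open>The index \<open>i\<close> depends on the outcome. Feasibility and bounds pass in this
  way from iterates to stored points.\<close>

lemma shom_point_cases: "\<exists>i\<le>k. shom_point S x k j \<omega> = x i \<omega>"
  by (induction k) (auto intro: le_SucI)

lemma shom_W_nonneg: "self_adjoint_pd B \<Longrightarrow> 0 \<le> shom_W B p N S x xs k \<omega>"
  unfolding shom_W_def by (intro avg_nonneg zero_le_power B_norm_nonneg)

lemma shom_W_le:
  assumes B: "self_adjoint_pd B" and N: "N \<noteq> 0"
    and K: "\<And>i. i \<le> k \<Longrightarrow> B_norm B (xs - x i \<omega>) \<le> K"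
  shows "shom_W B p N S x xs k \<omega> \<le> K ^ (p + 1)"
proof -
  have "B_norm B (xs - shom_point S x k j \<omega>) ^ (p + 1) \<le> K ^ (p + 1)" for j
  proof (rule power_mono)
    obtain i where i: "i \<le> k" "shom_point S x k j \<omega> = x i \<omega>" using shom_point_cases[of k S x j \<omega>] by blast
    show "B_norm B (xs - shom_point S x k j \<omega>) \<le> K" using K[OF i(1)] unfolding i(2) .
  qed (rule B_norm_nonneg[OF B])
  then have "shom_W B p N S x xs k \<omega> \<le> avg N (\<lambda>j. K ^ (p + 1))"
    unfolding shom_W_def by (intro avg_mono)
  also have "\<dots> = K ^ (p + 1)" by (rule avg_const[OF N])
  finally show ?thesis .
qed

context shom
begin

lemma N_nonzero: "N \<noteq> 0" using minibatch_size by simp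

lemma iterate_mem: "\<omega> \<in> space M \<Longrightarrow> x k \<omega> \<in> X"
  using step start start_feasible by (cases k) (auto simp: is_arg_min_def)

lemma shom_point_mem: "\<omega> \<in> space M \<Longrightarrow> shom_point S x k j \<omega> \<in> X"
  using shom_point_cases[of k S x j \<omega>] iterate_mem by auto

section \<open>Law of a minibatch and measurability with respect to the history\<close>

lemma S_measurable: "S i \<in> measurable M (count_space UNIV)"
  using S_independent by (simp add: indep_vars_def)

lemma prob_mem_minibatch:
  assumes "j \<in> {1..N}"
  shows "prob (S k -` {A. j \<in> A} \<inter> space M) = real \<tau> / real N"
proof -
  have "prob (S k -` {A. j \<in> A} \<inter> space M) = measure (distr M (count_space UNIV) (S k)) {A. j \<in> A}"
    by (rule measure_distr[symmetric]) (auto intro: S_measurable)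
  then show ?thesis using prob_uniform_subset_mem[OF assms minibatch_size] by (simp add: S_uniform)
qed

lemma iterate_measurable: "x k \<in> borel_measurable (history M S k)"
proof (cases k)
  case 0
  \<comment> \<open>The start is fixed only on \<open>space M\<close>, so constancy enters through a
    congruence.\<close>
  have "x 0 \<in> borel_measurable (history M S 0) \<longleftrightarrow> (\<lambda>_. x0) \<in> borel_measurable (history M S 0)"
    by (rule measurable_cong) (simp add: start)
  then show ?thesis using 0 by simp
next
  case (Suc n)
  then show ?thesis using borel_measurable_history_mono[OF adapted, of n "Suc n"] by simp
qed

lemma shom_point_measurable: "shom_point S x k j \<in> borel_measurable (history M S k)"
proof (induction k)
  case 0
  have "shom_point S x 0 j = x 0" by (rule ext) simp
  then show ?case using iterate_measurable[of 0] by simp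
next
  case (Suc k)
  have "{\<omega> \<in> space (history M S (Suc k)). j \<in> S (Suc k) \<omega>} = S (Suc k) -` {A. j \<in> A} \<inter> space M"
    by auto
  then have "{\<omega> \<in> space (history M S (Suc k)). j \<in> S (Suc k) \<omega>} \<in> sets (history M S (Suc k))"
    using vimage_in_history[of "Suc k" "Suc k" S "{A. j \<in> A}" M] by simp
  then show ?case
    unfolding shom_point.simps
    by (intro measurable_If iterate_measurable borel_measurable_history_mono[OF Suc]) simp_all
qed

lemma B_norm_measurable:
  assumes "self_adjoint_pd B" "u \<in> borel_measurable F"
  shows "(\<lambda>\<omega>. B_norm B (xs - u \<omega>)) \<in> borel_measurable F"
proof -
  have "B_norm B \<in> borel_measurable borel"
    by (rule borel_measurable_continuous_onI[OF continuous_on_B_norm[OF assms(1)]])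
  moreover have "(\<lambda>\<omega>. xs - u \<omega>) \<in> borel_measurable F" using assms(2) by simp
  ultimately show ?thesis by (rule measurable_compose[rotated])
qed

lemma shom_W_measurable:
  assumes "self_adjoint_pd B"
  shows "shom_W B p N S x xs k \<in> borel_measurable (history M S k)"
  unfolding shom_W_def[abs_def] avg_def
  by (intro borel_measurable_divide borel_measurable_sum borel_measurable_power
      B_norm_measurable[OF assms] shom_point_measurable) simp_all

text \<open>Only indices in the new minibatch change their stored point. The increments are
  determined by the past and the indicators by \<open>S (Suc k)\<close>, the shape needed for
  conditioning.\<close>

lemma shom_W_Suc:
  assumes "\<omega> \<in> space M"
  shows "shom_W B p N S x xs (Suc k) \<omega> = shom_W B p N S x xs k \<omega> +
    (\<Sum>j\<in>{1..N}. (B_norm B (xs - x (Suc k) \<omega>) ^ (p + 1) - B_norm B (xs - shom_point S x k j \<omega>) ^ (p + 1)) / real N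
       * indicator (S (Suc k) -` {A. j \<in> A} \<inter> space M) \<omega>)"
  unfolding shom_W_def avg_def sum_divide_distrib sum.distrib[symmetric]
  using assms by (intro sum.cong) (auto simp: indicator_def diff_divide_distrib)

lemma real_cond_exp_shom_W:
  assumes B: "self_adjoint_pd B"
    and K: "\<And>i \<omega>. i \<le> Suc k \<Longrightarrow> \<omega> \<in> space M \<Longrightarrow> B_norm B (xs - x i \<omega>) \<le> K"
  shows "AE \<omega> in M. real_cond_exp M (history M S k) (shom_W B p N S x xs (Suc k)) \<omega>
     = (1 - real \<tau> / real N) * shom_W B p N S x xs k \<omega>
       + real \<tau> / real N * B_norm B (xs - x (Suc k) \<omega>) ^ (p + 1)"
proof -
  let ?F = "history M S k" and ?W = "shom_W B p N S x xs"
  let ?a = "\<lambda>\<omega>. B_norm B (xs - x (Suc k) \<omega>) ^ (p + 1)"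
  let ?b = "\<lambda>j \<omega>. B_norm B (xs - shom_point S x k j \<omega>) ^ (p + 1)"
  let ?u = "\<lambda>j \<omega>. (?a \<omega> - ?b j \<omega>) / real N"
  let ?E = "\<lambda>j. S (Suc k) -` {A. j \<in> A} \<inter> space M"
  let ?Z = "\<lambda>\<omega>. \<Sum>j\<in>{1..N}. ?u j \<omega> * indicator (?E j) \<omega>"
  have sub: "subalgebra M (history M S i)" for i by (rule subalgebra_history[OF S_measurable])
  interpret F: finite_measure_subalgebra M ?F by unfold_locales (rule sub)
  have W_int: "integrable M (?W i)" if i: "i \<le> Suc k" for i
  proof (rule integrable_const_bound[of _ "K ^ (p + 1)"])
    show "AE \<omega> in M. norm (?W i \<omega>) \<le> K ^ (p + 1)"
    proof (rule AE_I2)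
      fix \<omega> assume "\<omega> \<in> space M"
      then have "?W i \<omega> \<le> K ^ (p + 1)" using i by (intro shom_W_le B N_nonzero K) simp_all
      then show "norm (?W i \<omega>) \<le> K ^ (p + 1)" using shom_W_nonneg[OF B, of p N S x xs i \<omega>] by simp
    qed
    show "?W i \<in> borel_measurable M" by (rule measurable_from_subalg[OF sub shom_W_measurable[OF B]])
  qed
  have Z: "?W (Suc k) \<omega> - ?W k \<omega> = ?Z \<omega>" if "\<omega> \<in> space M" for \<omega>
    using shom_W_Suc[OF that, of B p xs k] by simp
  have Z_int: "integrable M ?Z"
  proof -
    have "integrable M (\<lambda>\<omega>. ?W (Suc k) \<omega> - ?W k \<omega>)"
      by (intro Bochner_Integration.integrable_diff W_int) simp_all
    then show ?thesis by (simp only: Z cong: Bochner_Integration.integrable_cong)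
  qed
  have "AE \<omega> in M. real_cond_exp M ?F ?Z \<omega> = (\<Sum>j\<in>{1..N}. ?u j \<omega> * prob (?E j))"
  proof (rule real_cond_exp_sum_indep_indicators[OF sub])
    \<comment> \<open>\<open>adapted\<close> makes \<open>x (Suc k)\<close> known from the
      minibatches up to \<open>k\<close>, before \<open>S (Suc k)\<close> is drawn.\<close>
    show "?u j \<in> borel_measurable ?F" for j
      by (intro borel_measurable_divide borel_measurable_diff borel_measurable_power
          B_norm_measurable[OF B] shom_point_measurable adapted) simp
    show "\<bar>?u j \<omega>\<bar> \<le> K ^ (p + 1) / real N" if \<omega>: "\<omega> \<in> space M" for j \<omega>
    proof -
      obtain i where i: "i \<le> k" "shom_point S x k j \<omega> = x i \<omega>" using shom_point_cases[of k S x j \<omega>] by blast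
      have le: "B_norm B (xs - x n \<omega>) ^ (p + 1) \<le> K ^ (p + 1)" if "n \<le> Suc k" for n
        by (intro power_mono K \<omega> that B_norm_nonneg[OF B])
      have "0 \<le> ?a \<omega>" "0 \<le> ?b j \<omega>" using B_norm_nonneg[OF B] by (simp_all del: power_Suc)
      then have "\<bar>?a \<omega> - ?b j \<omega>\<bar> \<le> K ^ (p + 1)"
        using le[of "Suc k"] le[of i] i by (simp only: i(2)) linarith
      then show ?thesis by (simp add: divide_right_mono)
    qed
    show "?E j \<in> events" for j by (rule measurable_sets[OF S_measurable]) simp
    show "prob (A \<inter> ?E j) = prob A * prob (?E j)" if "A \<in> sets ?F" for j A
      by (rule history_indep_next[OF S_independent that])
  qed
  moreover have "AE \<omega> in M. real_cond_exp M ?F (\<lambda>\<omega>. ?W k \<omega> + ?Z \<omega>) \<omega>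
      = real_cond_exp M ?F (?W k) \<omega> + real_cond_exp M ?F ?Z \<omega>"
    by (rule F.real_cond_exp_add[OF W_int[of k] Z_int]) simp
  moreover have "AE \<omega> in M. real_cond_exp M ?F (?W k) \<omega> = ?W k \<omega>"
    by (rule F.real_cond_exp_F_meas[OF W_int[of k] shom_W_measurable[OF B]]) simp
  moreover have "AE \<omega> in M. real_cond_exp M ?F (?W (Suc k)) \<omega>
      = real_cond_exp M ?F (\<lambda>\<omega>. ?W k \<omega> + ?Z \<omega>) \<omega>"
  proof (rule F.real_cond_exp_cong)
    show "AE \<omega> in M. ?W (Suc k) \<omega> = ?W k \<omega> + ?Z \<omega>"
      by (intro AE_I2 shom_W_Suc)
  qed (use W_int[of "Suc k"] W_int[of k] Z_int in \<open>auto intro!: borel_measurable_add borel_measurable_integrable\<close>)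
  ultimately show ?thesis
  proof eventually_elim
    fix \<omega>
    assume eq: "real_cond_exp M ?F ?Z \<omega> = (\<Sum>j\<in>{1..N}. ?u j \<omega> * prob (?E j))"
      "real_cond_exp M ?F (\<lambda>\<omega>. ?W k \<omega> + ?Z \<omega>) \<omega> = real_cond_exp M ?F (?W k) \<omega> + real_cond_exp M ?F ?Z \<omega>"
      "real_cond_exp M ?F (?W k) \<omega> = ?W k \<omega>"
      "real_cond_exp M ?F (?W (Suc k)) \<omega> = real_cond_exp M ?F (\<lambda>\<omega>. ?W k \<omega> + ?Z \<omega>) \<omega>"
    have "(\<Sum>j\<in>{1..N}. ?u j \<omega> * prob (?E j)) = (\<Sum>j\<in>{1..N}. ?u j \<omega>) * (real \<tau> / real N)"
      unfolding sum_distrib_right by (intro sum.cong refl) (simp only: prob_mem_minibatch)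
    \<comment> \<open>Averaging the increments recovers \<open>?a - ?W k\<close>; adding
      \<open>\<tau> / N\<close> times this to \<open>?W k\<close> gives the convex
      combination.\<close>
    also have "(\<Sum>j\<in>{1..N}. ?u j \<omega>) = ?a \<omega> - ?W k \<omega>"
      using N_nonzero
      by (simp add: shom_W_def avg_def sum_subtractf diff_divide_distrib sum_divide_distrib[symmetric])
    finally show "real_cond_exp M ?F (?W (Suc k)) \<omega>
       = (1 - real \<tau> / real N) * ?W k \<omega> + real \<tau> / real N * ?a \<omega>"
      unfolding eq by (simp add: algebra_simps)
  qed
qed

text \<open>Boundedness of the iterates supplies the integrability needed for \<open>real_cond_exp\<close>.\<close>
lemma iterates_bounded:
  assumes B: "self_adjoint_pd B" and q: "q > 0" and C: "C \<ge> 0"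
    and decr: "\<And>k \<omega>. \<omega> \<in> space M \<Longrightarrow>
      B_norm B (xs - x (Suc k) \<omega>) powr q \<le> C * shom_W B p N S x xs k \<omega>"
  shows "\<exists>K. \<forall>i\<le>k. \<forall>\<omega>\<in>space M. B_norm B (xs - x i \<omega>) \<le> K"
proof (induction k)
  case 0
  then show ?case by (auto simp: start)
next
  case (Suc k)
  then obtain K where K: "\<And>i \<omega>. i \<le> k \<Longrightarrow> \<omega> \<in> space M \<Longrightarrow> B_norm B (xs - x i \<omega>) \<le> K" by blast
  have "B_norm B (xs - x (Suc k) \<omega>) \<le> (C * K ^ (p + 1)) powr (1 / q)" if \<omega>: "\<omega> \<in> space M" for \<omega>
  proof -
    have "B_norm B (xs - x (Suc k) \<omega>) powr q \<le> C * K ^ (p + 1)"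
      by (rule order_trans[OF decr[OF \<omega>]]) (intro mult_left_mono shom_W_le B N_nonzero K \<omega> C)
    then have "(B_norm B (xs - x (Suc k) \<omega>) powr q) powr (1 / q) \<le> (C * K ^ (p + 1)) powr (1 / q)"
      using q by (intro powr_mono2) simp_all
    then show ?thesis
      using q B_norm_nonneg[OF B] by (simp add: powr_powr)
  qed
  then have "\<forall>i\<le>Suc k. \<forall>\<omega>\<in>space M. B_norm B (xs - x i \<omega>) \<le> max K ((C * K ^ (p + 1)) powr (1 / q))"
    using K by (auto simp: le_Suc_eq le_max_iff_disj)
  then show ?case by blast
qed

text \<open>Strong induction along one outcome: if all iterates up to \<open>n\<close> lie in the
  ball, the Lyapunov value is at most \<open>R ^ (p + 1)\<close>. As \<open>e\<close> is
  nonnegative, the factor is then at most \<open>\<alpha> \<le> 1\<close>, so the next iterate lies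
  in the ball too.\<close>

lemma iterates_stay_in_ball:
  assumes B: "self_adjoint_pd B" and R: "R = B_norm B (xs - x0)" and \<alpha>: "\<alpha> \<le> 1"
    and e: "e \<ge> 0" and A: "A \<ge> 0" "A * (R ^ (p + 1)) powr e \<le> \<alpha>"
    and decr: "\<And>k. B_norm B (xs - x (Suc k) \<omega>) ^ (p + 1)
      \<le> A * shom_W B p N S x xs k \<omega> powr e * shom_W B p N S x xs k \<omega>"
    and \<omega>: "\<omega> \<in> space M"
  shows "B_norm B (xs - x k \<omega>) \<le> R"
    and "A * shom_W B p N S x xs k \<omega> powr e \<le> \<alpha>"
proof -
  have factor: "A * shom_W B p N S x xs k \<omega> powr e \<le> \<alpha>" "shom_W B p N S x xs k \<omega> \<le> R ^ (p + 1)"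
    if "\<And>i. i \<le> k \<Longrightarrow> B_norm B (xs - x i \<omega>) \<le> R" for k
  proof -
    show W: "shom_W B p N S x xs k \<omega> \<le> R ^ (p + 1)"
      by (intro shom_W_le B N_nonzero that)
    have "A * shom_W B p N S x xs k \<omega> powr e \<le> A * (R ^ (p + 1)) powr e"
      by (intro mult_left_mono powr_mono2 e A W shom_W_nonneg B)
    then show "A * shom_W B p N S x xs k \<omega> powr e \<le> \<alpha>" using A by linarith
  qed
  have all: "B_norm B (xs - x k \<omega>) \<le> R" for k
  proof (induction k rule: less_induct)
    case (less k)
    show ?case
    proof (cases k)
      case 0
      then show ?thesis using start[OF \<omega>] R by simp
    next
      case (Suc n)
      have IH: "\<And>i. i \<le> n \<Longrightarrow> B_norm B (xs - x i \<omega>) \<le> R" using less Suc by simp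
      have W0: "0 \<le> shom_W B p N S x xs n \<omega>" by (rule shom_W_nonneg[OF B])
      have "B_norm B (xs - x (Suc n) \<omega>) ^ (p + 1) \<le> 1 * shom_W B p N S x xs n \<omega>"
        using factor(1)[of n, OF IH] \<alpha> by (intro order_trans[OF decr] mult_right_mono W0) simp
      also have "\<dots> \<le> R ^ (p + 1)" using factor(2)[of n, OF IH] by simp
      finally have "B_norm B (xs - x (Suc n) \<omega>) ^ Suc p \<le> R ^ Suc p" by simp
      then show ?thesis
        unfolding Suc by (rule power_le_imp_le_base) (simp add: R B_norm_nonneg[OF B])
    qed
  qed
  then show "B_norm B (xs - x k \<omega>) \<le> R" "A * shom_W B p N S x xs k \<omega> powr e \<le> \<alpha>"
    using factor(1) by blast+
qed

end

text \<open>The radius solves the equation in which the factor equals \<open>\<alpha>\<close>. For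
  \<open>C = 0\<close> the radius is infinite, whereas division by zero would yield 0, hence the
  disjunction.\<close>

lemma contraction_factor_le:
  assumes "0 \<le> R" "0 < \<alpha>" "0 \<le> C" "0 < q" "q < real p + 1"
    and "C = 0 \<or> R \<le> \<alpha> powr (q / ((real p + 1)\<^sup>2 - q * (real p + 1))) / C powr (1 / (real p + 1 - q))"
  shows "C powr ((real p + 1) / q) * (R ^ (p + 1)) powr ((real p + 1 - q) / q) \<le> \<alpha>"
proof (cases "C = 0 \<or> R = 0")
  case True
  then show ?thesis using assms by auto
next
  case False
  with assms have C: "C > 0" and R: "R > 0" by auto
  define r where "r = real p + 1"
  \<comment> \<open>\<open>b\<close> is the total exponent of \<open>R\<close>. It is reciprocal to
    the exponent of \<open>\<alpha>\<close> in the radius and turns that of \<open>C\<close> into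
    \<open>r / q\<close>.\<close>
  define b where "b = r * (r - q) / q"
  have r: "r > 0" "q < r" using assms by (auto simp: r_def)
  have b: "b > 0" "q / (r\<^sup>2 - q * r) * b = 1" "1 / (r - q) * b = r / q"
    using r assms(4) by (auto simp: b_def power2_eq_square field_simps)
  have "(R ^ (p + 1)) powr ((r - q) / q) = R powr b"
    using R by (simp add: powr_realpow[symmetric] powr_powr r_def b_def add.commute del: power_Suc)
  also have "\<dots> \<le> (\<alpha> powr (q / (r\<^sup>2 - q * r)) / C powr (1 / (r - q))) powr b"
    using assms(6) R C b(1) by (intro powr_mono2) (auto simp: r_def)
  also have "\<dots> = \<alpha> / C powr (r / q)"
    using assms(2) C b by (simp only: powr_divide powr_powr) simp
  finally show ?thesis using C by (simp add: r_def field_simps)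
qed

theorem theorem5p8:
  fixes B :: "'a::euclidean_space \<Rightarrow> 'a \<Rightarrow>\<^sub>L real"
    and D X :: "'a set"
    and N p \<tau> :: nat
    and f :: "nat \<Rightarrow> 'a \<Rightarrow> real"
    and G :: "nat \<Rightarrow> 'a \<Rightarrow> 'a set"
    and g h :: "nat \<Rightarrow> 'a \<Rightarrow> 'a \<Rightarrow> real"
    and L :: "nat \<Rightarrow> real"
    and q \<sigma> Lh :: real
    and xstar x0 :: 'a
    and M :: "'w measure"
    and S :: "nat \<Rightarrow> 'w \<Rightarrow> nat set"
    and x :: "nat \<Rightarrow> 'w \<Rightarrow> 'a"
  defines "W \<equiv> shom_W B p N S x xstar"
    and "C \<equiv> Lh * q / (\<sigma> * fact (p + 1))"
  assumes "self_adjoint_pd B"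
    and "open D" and "X \<subseteq> D" and "closed X" and "convex X"
    and "\<And>i. i \<in> {1..N} \<Longrightarrow> lower_semicontinuous_on D (f i)"
    and "q \<ge> 2" and "\<sigma> > 0"
    and "uniformly_convex_on B q \<sigma> D (\<lambda>y. avg N (\<lambda>i. f i y))"
    and "p \<ge> 1"
    and "stochastic_surrogate B p N X D f G g h L"
    and "\<And>j. j \<in> {1..N} \<Longrightarrow> L j = Lh"
    and "is_arg_min (\<lambda>y. avg N (\<lambda>i. f i y)) (\<lambda>y. y \<in> X) xstar"
    and "shom M N \<tau> X g x0 S x"
  shows "(\<forall>k. AE \<omega> in M. real_cond_exp M (history M S k) (W (Suc k)) \<omega>
             \<le> (1 - real \<tau> / real N
                  + real \<tau> / real N * C powr ((real p + 1) / q)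
                      * W k \<omega> powr ((real p + 1 - q) / q)) * W k \<omega>) \<and>
         (\<forall>\<alpha>. 0 < \<alpha> \<and> \<alpha> < 1 \<and> q < real p + 1 \<and>
              (C = 0 \<or>
               B_norm B (x0 - xstar)
                 \<le> \<alpha> powr (q / ((real p + 1)\<^sup>2 - q * (real p + 1)))
                     / C powr (1 / (real p + 1 - q))) \<longrightarrow>
            (\<forall>k. AE \<omega> in M. real_cond_exp M (history M S k) (W (Suc k)) \<omega>
                   \<le> (1 - (1 - \<alpha>) * real \<tau> / real N) * W k \<omega>))"
proof -
  interpret shom M N \<tau> X g x0 S x by (rule assms)
  note B = \<open>self_adjoint_pd B\<close>
  have q: "q > 0" using \<open>q \<ge> 2\<close> by simp
  have sur: "stochastic_surrogate B p N X D f G g h (\<lambda>_. Lh)"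
    using assms(13,14) unfolding stochastic_surrogate_def by (metis (no_types, lifting))
  \<comment> \<open>Any one error function shows that the common constant is nonnegative; index 1
    exists because \<open>N\<close> is positive.\<close>
  have "1 \<in> {1..N}" using N_nonzero by simp
  then have "lipschitz_pth_derivative B p Lh (\<lambda>y. h 1 y x0)"
    using sur start_feasible unfolding stochastic_surrogate_def by blast
  then have C: "C \<ge> 0"
    using lipschitz_pth_derivative_nonneg[OF B] q \<open>\<sigma> > 0\<close> by (simp add: C_def)
  have decr: "B_norm B (xstar - x (Suc k) \<omega>) powr q \<le> C * W k \<omega>" if "\<omega> \<in> space M" for k \<omega>
    unfolding C_def W_def shom_W_def
    by (rule surrogate_minimizer_dist[OF B \<open>open D\<close> \<open>X \<subseteq> D\<close> \<open>convex X\<close> q \<open>\<sigma> > 0\<close> assms(11) sur assms(15)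
          shom_point_mem[OF that] step[OF that]])
  have W0: "0 \<le> W k \<omega>" for k \<omega> unfolding W_def by (rule shom_W_nonneg[OF B])
  let ?A = "C powr ((real p + 1) / q)" and ?e = "(real p + 1 - q) / q"
  have decr': "B_norm B (xstar - x (Suc k) \<omega>) ^ (p + 1) \<le> ?A * W k \<omega> powr ?e * W k \<omega>"
    if "\<omega> \<in> space M" for k \<omega>
    by (rule power_le_of_powr_le[OF B_norm_nonneg[OF B] C W0 q decr[OF that]])
  have main: "AE \<omega> in M. real_cond_exp M (history M S k) (W (Suc k)) \<omega>
      \<le> (1 - real \<tau> / real N + real \<tau> / real N * ?A * W k \<omega> powr ?e) * W k \<omega>" for k
  proof -
    obtain K where "\<forall>i\<le>Suc k. \<forall>\<omega>\<in>space M. B_norm B (xstar - x i \<omega>) \<le> K"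
      using iterates_bounded[OF B q C decr[unfolded W_def]] by blast
    then have "AE \<omega> in M. real_cond_exp M (history M S k) (W (Suc k)) \<omega>
      = (1 - real \<tau> / real N) * W k \<omega> + real \<tau> / real N * B_norm B (xstar - x (Suc k) \<omega>) ^ (p + 1)"
      unfolding W_def by (intro real_cond_exp_shom_W[OF B]) blast
    then show ?thesis using AE_space
    proof eventually_elim
      case (elim \<omega>)
      have "real \<tau> / real N * B_norm B (xstar - x (Suc k) \<omega>) ^ (p + 1)
          \<le> real \<tau> / real N * (?A * W k \<omega> powr ?e * W k \<omega>)"
        by (intro mult_left_mono decr' elim) simp
      then show ?case unfolding elim(1) by (simp only: distrib_right mult.assoc)
    qed
  qed
  have "AE \<omega> in M. real_cond_exp M (history M S k) (W (Suc k)) \<omega>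
          \<le> (1 - (1 - \<alpha>) * real \<tau> / real N) * W k \<omega>"
    if \<alpha>: "0 < \<alpha> \<and> \<alpha> < 1 \<and> q < real p + 1 \<and> (C = 0 \<or> B_norm B (x0 - xstar)
        \<le> \<alpha> powr (q / ((real p + 1)\<^sup>2 - q * (real p + 1))) / C powr (1 / (real p + 1 - q)))" for \<alpha> k
  proof -
    define R where "R = B_norm B (xstar - x0)"
    have "?A * (R ^ (p + 1)) powr ?e \<le> \<alpha>"
      using \<alpha> C q B_norm_nonneg[OF B]
      by (intro contraction_factor_le) (auto simp: R_def B_norm_minus_commute[OF B, of xstar])
    \<comment> \<open>The ball argument is applied to each outcome separately, so the factor bound
      holds everywhere on \<open>space M\<close>.\<close>
    then have "?A * W k \<omega> powr ?e \<le> \<alpha>" if "\<omega> \<in> space M" for \<omega>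
      using iterates_stay_in_ball(2)[OF B R_def _ _ _ _ decr'[unfolded W_def, OF that] that] \<alpha> q
      unfolding W_def by simp
    note factor = this
    show ?thesis using main[of k] AE_space
    proof eventually_elim
      case (elim \<omega>)
      have "(1 - real \<tau> / real N + real \<tau> / real N * (?A * W k \<omega> powr ?e)) * W k \<omega>
          \<le> (1 - real \<tau> / real N + real \<tau> / real N * \<alpha>) * W k \<omega>"
        by (intro mult_right_mono add_left_mono mult_left_mono factor elim W0) simp
      also have "1 - real \<tau> / real N + real \<tau> / real N * \<alpha> = 1 - (1 - \<alpha>) * real \<tau> / real N"
        using N_nonzero by (simp add: field_simps)
      finally show ?case using elim(1) by (simp only: mult.assoc)
    qed
  qed
  with main show ?thesis by blast
qed

end
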